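(* Let $\Lambda$ be any non-empty set. Then the Banach algebra $\mathbb{M}_{\Lambda}(\mathbb{C})$ has an ultra central approximate identity if and only if $\Lambda$ is finite.
   Context: $\mathbb{M}_{\Lambda}(\mathbb{C})$ denotes the Banach algebra of all $\Lambda\times\Lambda$-matrices $(a_{i,j})_{i,j\in\Lambda}$ over $\mathbb{C}$ with finite $\ell^{1}$-norm $\|(a_{i,j})\|=\sum_{i,j\in\Lambda}|a_{i,j}|<\infty$, equipped with matrix multiplication. For a Banach algebra $A$ and a Banach $A$-bimodule $X$, the dual $X^{*}$ is a Banach $A$-bimodule via $(a\cdot f)(x)=f(x\cdot a)$ and $(f\cdot a)(x)=f(a\cdot x)$ for $a\in A$, $x\in X$, $f\in X^{*}$. In particular $A^{**}$ is a Banach $A$-bimodule, and $A$ is regarded as a subspace of $A^{**}$ via the canonical embedding. A Banach algebra $A$ has an ultra central approximate identity if there exists a net $(e_{\alpha})$ in $A^{**}$ such that $ae_{\alpha}=e_{\alpha}a$ for every $\alpha$ and $e_{\alpha}a\rightarrow a$ (in the norm of $A^{**}$), for every $a\in A$. The net is not required to be bounded. *)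

theory Defs
  imports "HOL-Analysis.Analysis"
begin

section \<open>Complex Banach spaces and Banach algebras\<close>

text \<open>The library classes for normed spaces are real; scalar multiplication by complex numbers is
  added on top of them. Complex Banach algebras are not required to be unital.\<close>

class scaleC =
  fixes scaleC :: "complex \<Rightarrow> 'a \<Rightarrow> 'a" (infixr \<open>*\<^sub>C\<close> 75)

class complex_normed_vector = real_normed_vector + scaleC +
  assumes scaleC_add_right: "c *\<^sub>C (x + y) = c *\<^sub>C x + c *\<^sub>C y"
    and scaleC_add_left: "(c + d) *\<^sub>C x = c *\<^sub>C x + d *\<^sub>C x"
    and scaleC_scaleC: "c *\<^sub>C (d *\<^sub>C x) = (c * d) *\<^sub>C x"
    and scaleC_of_real: "complex_of_real r *\<^sub>C x = r *\<^sub>R x"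
    and norm_scaleC: "norm (c *\<^sub>C x) = cmod c * norm x"

class complex_banach = complex_normed_vector + banach

class complex_banach_algebra = complex_banach + real_normed_algebra +
  assumes mult_scaleC_left: "(c *\<^sub>C x) * y = c *\<^sub>C (x * y)"
    and mult_scaleC_right: "x * (c *\<^sub>C y) = c *\<^sub>C (x * y)"


section \<open>The dual space\<close>

text \<open>The norm is the operator norm inherited from the library type of bounded real-linear maps.\<close>

typedef (overloaded) 'a cdual =
    "{f :: 'a::complex_normed_vector \<Rightarrow>\<^sub>L complex. \<forall>c x. blinfun_apply f (c *\<^sub>C x) = c * blinfun_apply f x}"
  morphisms blinfun_of_cdual Abs_cdual
  by (rule exI[of _ 0]) simp

setup_lifting type_definition_cdual

lift_definition cdual_apply :: "'a::complex_normed_vector cdual \<Rightarrow> 'a \<Rightarrow> complex"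
  is blinfun_apply .

text \<open>Only meaningful for bounded complex-linear \<open>f\<close>.\<close>

definition Cdual :: "('a::complex_normed_vector \<Rightarrow> complex) \<Rightarrow> 'a cdual"
  where "Cdual f = Abs_cdual (Blinfun f)"

lemma cdual_apply_Cdual:
  assumes "bounded_linear f" "\<And>c x. f (c *\<^sub>C x) = c * f x"
  shows "cdual_apply (Cdual f) x = f x"
  using assms by (simp add: cdual_apply.rep_eq Cdual_def Abs_cdual_inverse bounded_linear_Blinfun_apply)

lemma cdual_eqI: "(\<And>x. cdual_apply f x = cdual_apply g x) \<Longrightarrow> f = g"
  by transfer (rule blinfun_eqI)

instantiation cdual :: (complex_normed_vector) complex_normed_vector
begin

lift_definition zero_cdual :: "'a cdual" is 0 by simp
lift_definition plus_cdual :: "'a cdual \<Rightarrow> 'a cdual \<Rightarrow> 'a cdual" is "(+)"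
  by (simp add: blinfun.add_left algebra_simps)
lift_definition minus_cdual :: "'a cdual \<Rightarrow> 'a cdual \<Rightarrow> 'a cdual" is "(-)"
  by (simp add: blinfun.diff_left algebra_simps)
lift_definition uminus_cdual :: "'a cdual \<Rightarrow> 'a cdual" is uminus
  by (simp add: blinfun.minus_left)
lift_definition scaleR_cdual :: "real \<Rightarrow> 'a cdual \<Rightarrow> 'a cdual" is scaleR
  by (simp add: blinfun.scaleR_left)
lift_definition scaleC_cdual :: "complex \<Rightarrow> 'a cdual \<Rightarrow> 'a cdual"
  is "\<lambda>c f. blinfun_compose (Blinfun ((*) c)) f"
  by (simp add: bounded_linear_Blinfun_apply bounded_linear_mult_right)
lift_definition norm_cdual :: "'a cdual \<Rightarrow> real" is norm .

definition dist_cdual :: "'a cdual \<Rightarrow> 'a cdual \<Rightarrow> real"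
  where "dist_cdual f g = norm (f - g)"
definition sgn_cdual :: "'a cdual \<Rightarrow> 'a cdual"
  where "sgn_cdual f = inverse (norm f) *\<^sub>R f"
definition uniformity_cdual :: "('a cdual \<times> 'a cdual) filter"
  where "uniformity_cdual = (INF e\<in>{0 <..}. principal {(f, g). dist f g < e})"
definition open_cdual :: "'a cdual set \<Rightarrow> bool"
  where "open_cdual S = (\<forall>x\<in>S. \<forall>\<^sub>F (x', y) in uniformity. x' = x \<longrightarrow> y \<in> S)"

instance
proof
  fix f g h :: "'a cdual" and r s :: real and c d :: complex and S :: "'a cdual set"
  have m: "blinfun_apply (Blinfun ((*) c)) = (*) c" for c :: complex
    by (simp add: bounded_linear_Blinfun_apply bounded_linear_mult_right)
  show "f + g + h = f + (g + h)" by transfer simp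
  show "f + g = g + f" by transfer simp
  show "0 + f = f" by transfer simp
  show "- f + f = 0" by transfer simp
  show "f - g = f + - g" by transfer simp
  show "r *\<^sub>R (f + g) = r *\<^sub>R f + r *\<^sub>R g" by transfer (simp add: scaleR_add_right)
  show "(r + s) *\<^sub>R f = r *\<^sub>R f + s *\<^sub>R f" by transfer (simp add: scaleR_add_left)
  show "r *\<^sub>R s *\<^sub>R f = (r * s) *\<^sub>R f" by transfer simp
  show "1 *\<^sub>R f = f" by transfer simp
  show "dist f g = norm (f - g)" by (rule dist_cdual_def)
  show "sgn f = inverse (norm f) *\<^sub>R f" by (simp add: sgn_cdual_def)
  show "uniformity = (INF e\<in>{0 <..}. principal {(f, g :: 'a cdual). dist f g < e})"
    by (rule uniformity_cdual_def)
  show "open S = (\<forall>x\<in>S. \<forall>\<^sub>F (x', y) in uniformity. x' = x \<longrightarrow> y \<in> S)"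
    by (rule open_cdual_def)
  show "(norm f = 0) = (f = 0)" by transfer simp
  show "norm (f + g) \<le> norm f + norm g" by transfer (rule norm_triangle_ineq)
  show "norm (r *\<^sub>R f) = \<bar>r\<bar> * norm f" by transfer simp
  show "c *\<^sub>C (f + g) = c *\<^sub>C f + c *\<^sub>C g"
    by transfer (auto intro!: blinfun_eqI simp: m blinfun.add_left algebra_simps)
  show "(c + d) *\<^sub>C f = c *\<^sub>C f + d *\<^sub>C f"
    by transfer (auto intro!: blinfun_eqI simp: m blinfun.add_left algebra_simps)
  show "c *\<^sub>C d *\<^sub>C f = (c * d) *\<^sub>C f"
    by transfer (auto intro!: blinfun_eqI simp: m)
  show "complex_of_real r *\<^sub>C f = r *\<^sub>R f"
    by transfer (auto intro!: blinfun_eqI simp: m blinfun.scaleR_left scaleR_conv_of_real)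
  have le: "norm (c *\<^sub>C f) \<le> cmod c * norm f" for c and f :: "'a cdual"
  proof (transfer fixing: c)
    fix f :: "'a \<Rightarrow>\<^sub>L complex"
    show "norm (Blinfun ((*) c) o\<^sub>L f) \<le> cmod c * norm f"
    proof (rule norm_blinfun_bound)
      fix x
      have "cmod c * cmod (blinfun_apply f x) \<le> cmod c * (norm f * norm x)"
        by (intro mult_left_mono norm_blinfun) auto
      then show "norm (blinfun_apply (Blinfun ((*) c) o\<^sub>L f) x) \<le> cmod c * norm f * norm x"
        by (simp add: m norm_mult algebra_simps)
    qed simp
  qed
  show "norm (c *\<^sub>C f) = cmod c * norm f"
  proof (cases "c = 0")
    case True
    moreover have "0 \<le> norm (0 *\<^sub>C f)" by transfer simp
    ultimately show ?thesis using le[of 0 f] by simp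
  next
    case False
    have "inverse c *\<^sub>C c *\<^sub>C f = f"
      using False by transfer (auto intro!: blinfun_eqI simp: m)
    then have "cmod c * norm f \<le> cmod c * (cmod (inverse c) * norm (c *\<^sub>C f))"
      using le[of "inverse c" "c *\<^sub>C f"] by (intro mult_left_mono) simp_all
    also have "\<dots> = norm (c *\<^sub>C f)"
      using False by (simp add: norm_inverse flip: mult.assoc)
    finally have "cmod c * norm f \<le> norm (c *\<^sub>C f)" .
    then show ?thesis using le[of c f] by simp
  qed
qed

end

lemma cdual_apply_simps [simp]:
  "cdual_apply 0 x = 0"
  "cdual_apply (f + g) x = cdual_apply f x + cdual_apply g x"
  "cdual_apply (f - g) x = cdual_apply f x - cdual_apply g x"
  "cdual_apply (- f) x = - cdual_apply f x"
  "cdual_apply (r *\<^sub>R f) x = r *\<^sub>R cdual_apply f x"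
  "cdual_apply (c *\<^sub>C f) x = c * cdual_apply f x"
  "cdual_apply f (c *\<^sub>C x) = c * cdual_apply f x"
  by (transfer, simp add: blinfun.bilinear_simps bounded_linear_Blinfun_apply bounded_linear_mult_right)+

lemma norm_cdual_apply: "cmod (cdual_apply f x) \<le> norm f * norm x"
  by transfer (rule norm_blinfun)

lemma norm_cdual_bound:
  "0 \<le> b \<Longrightarrow> (\<And>x. cmod (cdual_apply f x) \<le> b * norm x) \<Longrightarrow> norm f \<le> b"
  by transfer (rule norm_blinfun_bound)

lemma norm_cdual_eq_onorm: "norm f = onorm (cdual_apply f)"
  by (simp add: norm_cdual.rep_eq norm_blinfun.rep_eq cdual_apply.rep_eq)

lemma bounded_linear_cdual_apply: "bounded_linear (cdual_apply f)"
  by transfer (rule blinfun.bounded_linear_right)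

instance cdual :: (complex_normed_vector) complex_banach
proof
  fix X :: "nat \<Rightarrow> 'a cdual"
  assume "Cauchy X"
  then have "Cauchy (\<lambda>n. blinfun_of_cdual (X n))"
    unfolding Cauchy_def dist_norm
    by (simp add: norm_cdual.rep_eq minus_cdual.rep_eq)
  then obtain g where g: "(\<lambda>n. blinfun_of_cdual (X n)) \<longlonglongrightarrow> g"
    using Cauchy_convergent_iff convergent_def by blast
  have lim: "(\<lambda>n. cdual_apply (X n) x) \<longlonglongrightarrow> blinfun_apply g x" for x
    unfolding cdual_apply.rep_eq
    by (rule bounded_linear.tendsto[OF blinfun.bounded_linear_left g])
  have "blinfun_apply g (c *\<^sub>C x) = c * blinfun_apply g x" for c x
  proof (rule LIMSEQ_unique[OF lim])
    show "(\<lambda>n. cdual_apply (X n) (c *\<^sub>C x)) \<longlonglongrightarrow> c * blinfun_apply g x"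
      using tendsto_mult[OF tendsto_const lim] by simp
  qed
  then have r: "blinfun_of_cdual (Abs_cdual g) = g"
    by (simp add: Abs_cdual_inverse)
  have "X \<longlonglongrightarrow> Abs_cdual g"
    using g unfolding LIMSEQ_def dist_norm
    by (simp add: norm_cdual.rep_eq minus_cdual.rep_eq r)
  then show "convergent X" by (auto simp: convergent_def)
qed


section \<open>Banach bimodules and the dual bimodule\<close>

locale banach_bimodule =
  fixes lact :: "'a::complex_banach_algebra \<Rightarrow> 'x::complex_banach \<Rightarrow> 'x"
    and ract :: "'x \<Rightarrow> 'a \<Rightarrow> 'x"
  assumes bounded_bilinear_lact: "bounded_bilinear lact"
    and bounded_bilinear_ract: "bounded_bilinear ract"
    and lact_scaleC_left: "lact (c *\<^sub>C a) x = c *\<^sub>C lact a x"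
    and lact_scaleC_right: "lact a (c *\<^sub>C x) = c *\<^sub>C lact a x"
    and ract_scaleC_left: "ract (c *\<^sub>C x) a = c *\<^sub>C ract x a"
    and ract_scaleC_right: "ract x (c *\<^sub>C a) = c *\<^sub>C ract x a"
    and lact_mult: "lact (a * b) x = lact a (lact b x)"
    and ract_mult: "ract x (a * b) = ract (ract x a) b"
    and lact_ract: "ract (lact a x) b = lact a (ract x b)"

text \<open>\<open>(a \<cdot> f)(x) = f(x \<cdot> a)\<close>, so the left action on the dual comes from the right action on the
  predual, and vice versa.\<close>

definition dual_lact ::
    "('x::complex_normed_vector \<Rightarrow> 'a \<Rightarrow> 'x) \<Rightarrow> 'a \<Rightarrow> 'x cdual \<Rightarrow> 'x cdual"
  where "dual_lact ract a f = Cdual (\<lambda>x. cdual_apply f (ract x a))"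

definition dual_ract ::
    "('a \<Rightarrow> 'x::complex_normed_vector \<Rightarrow> 'x) \<Rightarrow> 'x cdual \<Rightarrow> 'a \<Rightarrow> 'x cdual"
  where "dual_ract lact f a = Cdual (\<lambda>x. cdual_apply f (lact a x))"

context banach_bimodule
begin

interpretation L: bounded_bilinear lact by (rule bounded_bilinear_lact)
interpretation R: bounded_bilinear ract by (rule bounded_bilinear_ract)

lemma dual_lact_apply: "cdual_apply (dual_lact ract a f) x = cdual_apply f (ract x a)"
  unfolding dual_lact_def
  by (rule cdual_apply_Cdual)
    (auto intro: bounded_linear_compose[OF bounded_linear_cdual_apply R.bounded_linear_left]
      simp: ract_scaleC_left)

lemma dual_ract_apply: "cdual_apply (dual_ract lact f a) x = cdual_apply f (lact a x)"
  unfolding dual_ract_def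
  by (rule cdual_apply_Cdual)
    (auto intro: bounded_linear_compose[OF bounded_linear_cdual_apply L.bounded_linear_right]
      simp: lact_scaleC_right)

lemma banach_bimodule_dual: "banach_bimodule (dual_lact ract) (dual_ract lact)"
proof
  note add = linear_add[OF bounded_linear.linear[OF bounded_linear_cdual_apply]]
  note scale = linear_scale[OF bounded_linear.linear[OF bounded_linear_cdual_apply]]
  note [simp] = dual_lact_apply dual_ract_apply add scale L.add_left L.add_right R.add_left
    R.add_right L.scaleR_left L.scaleR_right R.scaleR_left R.scaleR_right
    lact_scaleC_left lact_scaleC_right ract_scaleC_left ract_scaleC_right lact_mult ract_mult
    lact_ract
  fix a b :: 'a and f g :: "'x cdual" and r :: real and c :: complex
  show "dual_lact ract (a + b) f = dual_lact ract a f + dual_lact ract b f"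
    "dual_lact ract a (f + g) = dual_lact ract a f + dual_lact ract a g"
    "dual_lact ract (r *\<^sub>R a) f = r *\<^sub>R dual_lact ract a f"
    "dual_lact ract a (r *\<^sub>R f) = r *\<^sub>R dual_lact ract a f"
    "dual_ract lact (f + g) a = dual_ract lact f a + dual_ract lact g a"
    "dual_ract lact f (a + b) = dual_ract lact f a + dual_ract lact f b"
    "dual_ract lact (r *\<^sub>R f) a = r *\<^sub>R dual_ract lact f a"
    "dual_ract lact f (r *\<^sub>R a) = r *\<^sub>R dual_ract lact f a"
    "dual_lact ract (c *\<^sub>C a) f = c *\<^sub>C dual_lact ract a f"
    "dual_lact ract a (c *\<^sub>C f) = c *\<^sub>C dual_lact ract a f"
    "dual_ract lact (c *\<^sub>C f) a = c *\<^sub>C dual_ract lact f a"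
    "dual_ract lact f (c *\<^sub>C a) = c *\<^sub>C dual_ract lact f a"
    "dual_lact ract (a * b) f = dual_lact ract a (dual_lact ract b f)"
    "dual_ract lact f (a * b) = dual_ract lact (dual_ract lact f a) b"
    "dual_ract lact (dual_lact ract a f) b = dual_lact ract a (dual_ract lact f b)"
    by (auto intro!: cdual_eqI)
  obtain K where K: "0 \<le> K" "\<And>x a. norm (ract x a) \<le> norm x * norm a * K"
    using R.nonneg_bounded by auto
  show "\<exists>K. \<forall>a f. norm (dual_lact ract a f) \<le> norm a * norm f * K"
  proof (intro exI[of _ K] allI norm_cdual_bound)
    fix a :: 'a and f :: "'x cdual" and x :: 'x
    have "cmod (cdual_apply f (ract x a)) \<le> norm f * (norm x * norm a * K)"
      by (rule order_trans[OF norm_cdual_apply]) (intro mult_left_mono K norm_ge_zero)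
    then show "cmod (cdual_apply (dual_lact ract a f) x) \<le> norm a * norm f * K * norm x"
      by (simp add: mult_ac)
  qed (use K in simp)
  obtain M where M: "0 \<le> M" "\<And>x a. norm (lact a x) \<le> norm a * norm x * M"
    using L.nonneg_bounded by auto
  show "\<exists>K. \<forall>f a. norm (dual_ract lact f a) \<le> norm f * norm a * K"
  proof (intro exI[of _ M] allI norm_cdual_bound)
    fix a :: 'a and f :: "'x cdual" and x :: 'x
    have "cmod (cdual_apply f (lact a x)) \<le> norm f * (norm a * norm x * M)"
      by (rule order_trans[OF norm_cdual_apply]) (intro mult_left_mono M norm_ge_zero)
    then show "cmod (cdual_apply (dual_ract lact f a) x) \<le> norm f * norm a * M * norm x"
      by (simp add: mult_ac)
  qed (use M in simp)
qed

end

lemma banach_bimodule_mult: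
  "banach_bimodule ((*) :: 'a::complex_banach_algebra \<Rightarrow> 'a \<Rightarrow> 'a) (*)"
  by (rule banach_bimodule.intro)
    (simp_all only: bounded_bilinear_mult mult_scaleC_left mult_scaleC_right mult.assoc)


section \<open>Ultra central approximate identities\<close>

type_synonym 'a bidual = "'a cdual cdual"

definition bidual_lact :: "'a::complex_banach_algebra \<Rightarrow> 'a bidual \<Rightarrow> 'a bidual"
  where "bidual_lact = dual_lact (dual_ract (*))"

definition bidual_ract :: "'a::complex_banach_algebra bidual \<Rightarrow> 'a \<Rightarrow> 'a bidual"
  where "bidual_ract = dual_ract (dual_lact (*))"

definition bidual_embed :: "'a::complex_normed_vector \<Rightarrow> 'a bidual"
  where "bidual_embed a = Cdual (\<lambda>f. cdual_apply f a)"

lemma bidual_embed_apply: "cdual_apply (bidual_embed a) f = cdual_apply f a"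
  unfolding bidual_embed_def
proof (rule cdual_apply_Cdual)
  show "bounded_linear (\<lambda>f. cdual_apply f a)"
    by (rule bounded_linear_intro[of _ "norm a"]) (auto simp: norm_cdual_apply)
qed auto

lemma banach_bimodule_bidual: "banach_bimodule bidual_lact bidual_ract"
  unfolding bidual_lact_def bidual_ract_def
  by (rule banach_bimodule.banach_bimodule_dual[OF
        banach_bimodule.banach_bimodule_dual[OF banach_bimodule_mult]])

definition directed_index :: "'i set \<Rightarrow> ('i \<Rightarrow> 'i \<Rightarrow> bool) \<Rightarrow> bool"
  where "directed_index I le \<longleftrightarrow> I \<noteq> {} \<and> reflp_on I le \<and> transp_on I le \<and>
    (\<forall>i\<in>I. \<forall>j\<in>I. \<exists>k\<in>I. le i k \<and> le j k)"

definition net_filter :: "'i set \<Rightarrow> ('i \<Rightarrow> 'i \<Rightarrow> bool) \<Rightarrow> 'i filter"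
  where "net_filter I le = (INF i\<in>I. principal {j\<in>I. le i j})"

lemma eventually_net_filter:
  assumes "directed_index I le"
  shows "eventually P (net_filter I le) \<longleftrightarrow> (\<exists>i\<in>I. \<forall>j\<in>I. le i j \<longrightarrow> P j)"
  unfolding net_filter_def
proof (subst eventually_INF_base)
  show "I \<noteq> {}" using assms by (simp add: directed_index_def)
  fix i j assume "i \<in> I" "j \<in> I"
  then obtain k where k: "k \<in> I" "le i k" "le j k"
    using assms unfolding directed_index_def by blast
  have t: "transp_on I le" using assms by (simp add: directed_index_def)
  have "le i x \<and> le j x" if "x \<in> I" "le k x" for x
    using transp_onD[OF t \<open>i \<in> I\<close> k(1) that(1) k(2) that(2)]
      transp_onD[OF t \<open>j \<in> I\<close> k(1) that(1) k(3) that(2)] by blast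
  then show "\<exists>x\<in>I. principal {j \<in> I. le x j}
      \<le> inf (principal {j \<in> I. le i j}) (principal {ja \<in> I. le j ja})"
    using k(1) by (intro bexI[of _ k]) auto
qed (auto simp: eventually_principal)

definition ultra_central_approximate_identity ::
    "'i set \<Rightarrow> ('i \<Rightarrow> 'i \<Rightarrow> bool) \<Rightarrow> ('i \<Rightarrow> 'a::complex_banach_algebra bidual) \<Rightarrow> bool"
  where "ultra_central_approximate_identity I le e \<longleftrightarrow> directed_index I le \<and>
    (\<forall>\<alpha>\<in>I. \<forall>a. bidual_lact a (e \<alpha>) = bidual_ract (e \<alpha>) a) \<and>
    (\<forall>a. ((\<lambda>\<alpha>. bidual_ract (e \<alpha>) a) \<longlongrightarrow> bidual_embed a) (net_filter I le))"

text \<open>A definition cannot quantify over the type of the indices of a net. The index type fixed here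
  is large enough: by the lemma that follows, nets over any other index type yield the same notion.\<close>

definition has_ultra_central_approximate_identity :: "'a::complex_banach_algebra itself \<Rightarrow> bool"
  where "has_ultra_central_approximate_identity _ \<longleftrightarrow>
    (\<exists>(I :: ('a bidual \<times> 'a bidual set) set) le (e :: _ \<Rightarrow> 'a bidual).
      ultra_central_approximate_identity I le e)"

lemma has_ultra_central_approximate_identityI:
  fixes I :: "'i set" and e :: "'i \<Rightarrow> 'a::complex_banach_algebra bidual"
  assumes "ultra_central_approximate_identity I le e"
  shows "has_ultra_central_approximate_identity TYPE('a)"
proof -
  have d: "directed_index I le"
    and c: "\<And>\<alpha> a. \<alpha> \<in> I \<Longrightarrow> bidual_lact a (e \<alpha>) = bidual_ract (e \<alpha>) a"
    and lim: "\<And>a. ((\<lambda>\<alpha>. bidual_ract (e \<alpha>) a) \<longlongrightarrow> bidual_embed a) (net_filter I le)"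
    using assms by (auto simp: ultra_central_approximate_identity_def)
  define T where "T i = e ` {j\<in>I. le i j}" for i
  define J where "J = {(x, S). \<exists>i\<in>I. x \<in> T i \<and> T i \<subseteq> S}"
  define leJ where "leJ = (\<lambda>(p :: 'a bidual \<times> 'a bidual set) (q :: 'a bidual \<times> 'a bidual set). snd q \<subseteq> snd p)"
  have refl: "le i i" if "i \<in> I" for i
    using d that by (auto simp: directed_index_def reflp_on_def)
  have inJ: "(e i, T i) \<in> J" if "i \<in> I" for i
    using that refl by (auto simp: J_def T_def)
  have dJ: "directed_index J leJ"
    unfolding directed_index_def
  proof (intro conjI ballI)
    show "J \<noteq> {}" using d inJ by (auto simp: directed_index_def)
    show "reflp_on J leJ" by (auto simp: leJ_def reflp_on_def)
    show "transp_on J leJ" by (auto simp: leJ_def transp_on_def)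
    fix p q assume "p \<in> J" "q \<in> J"
    then obtain i j where ij: "i \<in> I" "j \<in> I" "T i \<subseteq> snd p" "T j \<subseteq> snd q"
      by (auto simp: J_def)
    obtain k where k: "k \<in> I" "le i k" "le j k"
      using d ij unfolding directed_index_def by blast
    have "transp_on I le" using d by (simp add: directed_index_def)
    then have "T k \<subseteq> T i" "T k \<subseteq> T j"
      using k ij unfolding T_def by (auto dest: transp_onD)
    then show "\<exists>k\<in>J. leJ p k \<and> leJ q k"
      using ij inJ[OF k(1)] by (intro bexI[of _ "(e k, T k)"]) (auto simp: leJ_def)
  qed
  have "ultra_central_approximate_identity J leJ fst"
    unfolding ultra_central_approximate_identity_def
  proof (intro conjI ballI allI)
    show "directed_index J leJ" by (rule dJ)
    show "bidual_lact a (fst p) = bidual_ract (fst p) a" if "p \<in> J" for p a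
      using that c by (auto simp: J_def T_def)
    show "((\<lambda>p. bidual_ract (fst p) a) \<longlongrightarrow> bidual_embed a) (net_filter J leJ)" for a
    proof (rule topological_tendstoI)
      fix U assume "open U" "bidual_embed a \<in> U"
      from topological_tendstoD[OF lim this]
      obtain i where i: "i \<in> I" "\<And>j. j \<in> I \<Longrightarrow> le i j \<Longrightarrow> bidual_ract (e j) a \<in> U"
        unfolding eventually_net_filter[OF d] by blast
      have "bidual_ract (fst p) a \<in> U" if "p \<in> J" "leJ (e i, T i) p" for p
      proof -
        have "fst p \<in> snd p" "snd p \<subseteq> T i" using that by (auto simp: J_def leJ_def)
        then have "fst p \<in> T i" by blast
        then show ?thesis using i(2) by (auto simp: T_def)
      qed
      then show "eventually (\<lambda>p. bidual_ract (fst p) a \<in> U) (net_filter J leJ)"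
        unfolding eventually_net_filter[OF dJ] using inJ[OF i(1)] by blast
    qed
  qed
  then show ?thesis
    unfolding has_ultra_central_approximate_identity_def by (intro exI)
qed


section \<open>The Banach algebra of matrices with finite \<open>\<ell>\<^sup>1\<close>-norm\<close>

typedef 'l l1_matrix =
    "{a :: 'l \<Rightarrow> 'l \<Rightarrow> complex. (\<lambda>(i, j). cmod (a i j)) summable_on UNIV}"
  morphisms entry Abs_l1_matrix
  by (rule exI[of _ "\<lambda>_ _. 0"]) (simp add: case_prod_unfold)

setup_lifting type_definition_l1_matrix

lemma l1_matrix_eqI: "(\<And>i j. entry a i j = entry b i j) \<Longrightarrow> a = b"
  by transfer auto

abbreviation l1_summable :: "('l \<Rightarrow> 'l \<Rightarrow> complex) \<Rightarrow> bool"
  where "l1_summable a \<equiv> (\<lambda>(i, j). cmod (a i j)) summable_on UNIV"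

abbreviation l1_norm :: "('l \<Rightarrow> 'l \<Rightarrow> complex) \<Rightarrow> real"
  where "l1_norm a \<equiv> \<Sum>\<^sub>\<infinity>(i, j)\<in>UNIV. cmod (a i j)"

lemma l1_summable_add:
  assumes "l1_summable a" "l1_summable b"
  shows "l1_summable (\<lambda>i j. a i j + b i j)" "l1_norm (\<lambda>i j. a i j + b i j) \<le> l1_norm a + l1_norm b"
proof -
  have s: "(\<lambda>p. cmod (a (fst p) (snd p)) + cmod (b (fst p) (snd p))) summable_on UNIV"
    using assms by (intro summable_on_add) (auto simp: case_prod_unfold)
  show *: "l1_summable (\<lambda>i j. a i j + b i j)"
    unfolding case_prod_unfold
    by (rule Infinite_Sum.abs_summable_on_comparison_test'[OF s]) (rule norm_triangle_ineq)
  have "l1_norm (\<lambda>i j. a i j + b i j)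
      \<le> (\<Sum>\<^sub>\<infinity>p. cmod (a (fst p) (snd p)) + cmod (b (fst p) (snd p)))"
    using * s by (intro infsum_mono) (auto simp: case_prod_unfold norm_triangle_ineq)
  also have "\<dots> = l1_norm a + l1_norm b"
    using assms by (subst infsum_add) (auto simp: case_prod_unfold)
  finally show "l1_norm (\<lambda>i j. a i j + b i j) \<le> l1_norm a + l1_norm b" .
qed

lemma l1_summable_cmult:
  assumes "l1_summable a"
  shows "l1_summable (\<lambda>i j. c * a i j)" "l1_norm (\<lambda>i j. c * a i j) = cmod c * l1_norm a"
  using assms
  by (auto simp: case_prod_unfold norm_mult infsum_cmult_right intro!: summable_on_cmult_right)

lemma l1_norm_entry:
  assumes "l1_summable a" shows "cmod (a i j) \<le> l1_norm a"
proof -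
  have "sum (\<lambda>(i, j). cmod (a i j)) {(i, j)} \<le> l1_norm a"
    by (rule finite_sum_le_infsum) (use assms in \<open>auto simp: case_prod_unfold\<close>)
  then show ?thesis by simp
qed

lemma l1_summable_mult:
  fixes a b :: "'l \<Rightarrow> 'l \<Rightarrow> complex"
  assumes a: "l1_summable a" and b: "l1_summable b"
  shows l1_summable_mult_row: "(\<lambda>k. a i k * b k j) summable_on UNIV"
    and "l1_summable (\<lambda>i j. \<Sum>\<^sub>\<infinity>k. a i k * b k j)"
    and "l1_norm (\<lambda>i j. \<Sum>\<^sub>\<infinity>k. a i k * b k j) \<le> l1_norm a * l1_norm b"
proof -
  let ?A = "\<lambda>p. cmod (a (fst p) (snd p))" and ?B = "\<lambda>p. cmod (b (fst p) (snd p))"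
  have A: "?A summable_on UNIV" and B: "?B summable_on UNIV"
    using a b by (auto simp: case_prod_unfold)
  have AB: "(\<lambda>(p, q). ?A p * ?B q) summable_on UNIV \<times> UNIV"
  proof (rule summable_on_SigmaI)
    show "((\<lambda>q. case (p, q) of (p, q) \<Rightarrow> ?A p * ?B q) has_sum ?A p * infsum ?B UNIV) UNIV" for p
      using has_sum_cmult_right[OF has_sum_infsum[OF B], of "?A p"] by simp
    show "(\<lambda>p. ?A p * infsum ?B UNIV) summable_on UNIV"
      by (rule summable_on_cmult_left[OF A])
  qed auto
  have ABsum: "infsum (\<lambda>(p, q). ?A p * ?B q) (UNIV \<times> UNIV) = l1_norm a * l1_norm b"
  proof -
    have "infsum (\<lambda>(p, q). ?A p * ?B q) (UNIV \<times> UNIV) = (\<Sum>\<^sub>\<infinity>p. \<Sum>\<^sub>\<infinity>q. ?A p * ?B q)"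
      using AB by (subst infsum_Sigma'_banach) auto
    also have "\<dots> = infsum ?A UNIV * infsum ?B UNIV"
      by (simp add: infsum_cmult_right' infsum_cmult_left')
    finally show ?thesis by (simp add: case_prod_unfold)
  qed
  define g :: "('l \<times> 'l) \<times> 'l \<Rightarrow> ('l \<times> 'l) \<times> ('l \<times> 'l)"
    where "g = (\<lambda>((i, j), k). ((i, k), (k, j)))"
  have inj: "inj_on g (UNIV \<times> UNIV)" by (auto simp: inj_on_def g_def)
  let ?T = "\<lambda>((i, j), k). cmod (a i k * b k j)"
  have Tg: "?T = (\<lambda>(p, q). ?A p * ?B q) \<circ> g"
    by (auto simp: g_def fun_eq_iff norm_mult)
  have gs: "(\<lambda>(p, q). ?A p * ?B q) summable_on g ` (UNIV \<times> UNIV)"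
    by (rule summable_on_subset_banach[OF AB]) auto
  have T: "?T summable_on UNIV \<times> UNIV"
    unfolding Tg using gs by (subst summable_on_reindex[OF inj, symmetric])
  have "infsum ?T (UNIV \<times> UNIV) = infsum (\<lambda>(p, q). ?A p * ?B q) (g ` (UNIV \<times> UNIV))"
    unfolding Tg by (rule infsum_reindex[OF inj, symmetric])
  also have "\<dots> \<le> infsum (\<lambda>(p, q). ?A p * ?B q) (UNIV \<times> UNIV)"
    by (rule infsum_mono2[OF gs AB]) auto
  finally have Tle: "infsum ?T (UNIV \<times> UNIV) \<le> l1_norm a * l1_norm b"
    unfolding ABsum .
  have T': "(\<lambda>(p, k). cmod (a (fst p) k * b k (snd p))) summable_on UNIV \<times> UNIV"
    using T by (simp add: case_prod_unfold)
  have row: "(\<lambda>k. cmod (a i k * b k j)) summable_on UNIV" for i j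
    using summable_on_SigmaD1[OF T', of "(i, j)"] by simp
  show "(\<lambda>k. a i k * b k j) summable_on UNIV"
    by (rule abs_summable_summable[OF row])
  have S: "(\<lambda>p. \<Sum>\<^sub>\<infinity>k. cmod (a (fst p) k * b k (snd p))) summable_on UNIV"
    by (rule summable_on_Sigma_banach[OF T'])
  have le: "cmod (\<Sum>\<^sub>\<infinity>k. a i k * b k j) \<le> (\<Sum>\<^sub>\<infinity>k. cmod (a i k * b k j))" for i j
    by (rule norm_infsum_bound[OF row])
  show *: "l1_summable (\<lambda>i j. \<Sum>\<^sub>\<infinity>k. a i k * b k j)"
    unfolding case_prod_unfold
    by (rule Infinite_Sum.abs_summable_on_comparison_test'[OF S]) (rule le)
  have "l1_norm (\<lambda>i j. \<Sum>\<^sub>\<infinity>k. a i k * b k j) \<le> (\<Sum>\<^sub>\<infinity>p. \<Sum>\<^sub>\<infinity>k. cmod (a (fst p) k * b k (snd p)))"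
    using * S by (intro infsum_mono) (auto simp: case_prod_unfold intro: le)
  also have "\<dots> = infsum ?T (UNIV \<times> UNIV)"
    using infsum_Sigma'_banach[OF T'] by (simp add: case_prod_unfold)
  finally show "l1_norm (\<lambda>i j. \<Sum>\<^sub>\<infinity>k. a i k * b k j) \<le> l1_norm a * l1_norm b"
    using Tle by linarith
qed

lemma l1_mult_assoc:
  fixes a b c :: "'l \<Rightarrow> 'l \<Rightarrow> complex"
  assumes a: "l1_summable a" and b: "l1_summable b" and c: "l1_summable c"
  shows "(\<Sum>\<^sub>\<infinity>k. (\<Sum>\<^sub>\<infinity>l. a i l * b l k) * c k j) = (\<Sum>\<^sub>\<infinity>l. a i l * (\<Sum>\<^sub>\<infinity>k. b l k * c k j))"
proof -
  have "(\<lambda>p. cmod ((\<lambda>(l, k). a i l * b l k * c k j) p)) summable_on UNIV"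
  proof (rule Infinite_Sum.abs_summable_on_comparison_test')
    show "(\<lambda>(l, k). l1_norm a * l1_norm c * cmod (b l k)) summable_on UNIV"
      using b by (auto simp: case_prod_unfold intro!: summable_on_cmult_right)
    fix p :: "'l \<times> 'l"
    obtain l k where p: "p = (l, k)" by (cases p)
    have "cmod (a i l) * cmod (c k j) * cmod (b l k) \<le> l1_norm a * l1_norm c * cmod (b l k)"
      by (intro mult_right_mono mult_mono l1_norm_entry a c infsum_nonneg) auto
    then show "cmod (case p of (l, k) \<Rightarrow> a i l * b l k * c k j)
        \<le> (case p of (l, k) \<Rightarrow> l1_norm a * l1_norm c * cmod (b l k))"
      by (simp add: p norm_mult mult_ac)
  qed
  then have "(\<lambda>(l, k). a i l * b l k * c k j) summable_on UNIV \<times> UNIV"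
    by (simp add: abs_summable_summable)
  note swap = infsum_swap_banach[OF this]
  have "(\<Sum>\<^sub>\<infinity>k. (\<Sum>\<^sub>\<infinity>l. a i l * b l k) * c k j) = (\<Sum>\<^sub>\<infinity>k. \<Sum>\<^sub>\<infinity>l. a i l * b l k * c k j)"
    by (intro infsum_cong infsum_cmult_left'[symmetric])
  also have "\<dots> = (\<Sum>\<^sub>\<infinity>l. \<Sum>\<^sub>\<infinity>k. a i l * b l k * c k j)"
    by (rule swap[symmetric])
  also have "\<dots> = (\<Sum>\<^sub>\<infinity>l. \<Sum>\<^sub>\<infinity>k. a i l * (b l k * c k j))"
    by (simp only: mult.assoc)
  also have "\<dots> = (\<Sum>\<^sub>\<infinity>l. a i l * (\<Sum>\<^sub>\<infinity>k. b l k * c k j))"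
    by (intro infsum_cong infsum_cmult_right')
  finally show ?thesis .
qed

instantiation l1_matrix :: (type) complex_normed_vector
begin

lift_definition zero_l1_matrix :: "'a l1_matrix" is "\<lambda>_ _. 0"
  by (simp add: case_prod_unfold)
lift_definition plus_l1_matrix :: "'a l1_matrix \<Rightarrow> 'a l1_matrix \<Rightarrow> 'a l1_matrix"
  is "\<lambda>a b i j. a i j + b i j" by (rule l1_summable_add)
lift_definition minus_l1_matrix :: "'a l1_matrix \<Rightarrow> 'a l1_matrix \<Rightarrow> 'a l1_matrix"
  is "\<lambda>a b i j. a i j - b i j"
  subgoal for a b using l1_summable_add(1)[of a "\<lambda>i j. (-1) * b i j"] l1_summable_cmult(1)[of b "-1"]
    by simp
  done
lift_definition uminus_l1_matrix :: "'a l1_matrix \<Rightarrow> 'a l1_matrix" is "\<lambda>a i j. - a i j"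
  by (simp add: case_prod_unfold)
lift_definition scaleR_l1_matrix :: "real \<Rightarrow> 'a l1_matrix \<Rightarrow> 'a l1_matrix"
  is "\<lambda>r a i j. r *\<^sub>R a i j" unfolding scaleR_conv_of_real by (rule l1_summable_cmult)
lift_definition scaleC_l1_matrix :: "complex \<Rightarrow> 'a l1_matrix \<Rightarrow> 'a l1_matrix"
  is "\<lambda>c a i j. c * a i j" by (rule l1_summable_cmult)
lift_definition norm_l1_matrix :: "'a l1_matrix \<Rightarrow> real"
  is "\<lambda>a. \<Sum>\<^sub>\<infinity>(i, j)\<in>UNIV. cmod (a i j)" .

definition dist_l1_matrix :: "'a l1_matrix \<Rightarrow> 'a l1_matrix \<Rightarrow> real"
  where "dist_l1_matrix a b = norm (a - b)"
definition sgn_l1_matrix :: "'a l1_matrix \<Rightarrow> 'a l1_matrix"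
  where "sgn_l1_matrix a = inverse (norm a) *\<^sub>R a"
definition uniformity_l1_matrix :: "('a l1_matrix \<times> 'a l1_matrix) filter"
  where "uniformity_l1_matrix = (INF e\<in>{0 <..}. principal {(a, b). dist a b < e})"
definition open_l1_matrix :: "'a l1_matrix set \<Rightarrow> bool"
  where "open_l1_matrix S = (\<forall>x\<in>S. \<forall>\<^sub>F (x', y) in uniformity. x' = x \<longrightarrow> y \<in> S)"

instance
proof
  fix a b c :: "'a l1_matrix" and r s :: real and z w :: complex and S :: "'a l1_matrix set"
  show "a + b + c = a + (b + c)" by transfer (simp add: add.assoc)
  show "a + b = b + a" by transfer (simp add: add.commute)
  show "0 + a = a" by transfer simp
  show "- a + a = 0" by transfer simp
  show "a - b = a + - b" by transfer simp
  show "r *\<^sub>R (a + b) = r *\<^sub>R a + r *\<^sub>R b" by transfer (simp add: scaleR_add_right)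
  show "(r + s) *\<^sub>R a = r *\<^sub>R a + s *\<^sub>R a" by transfer (simp add: scaleR_add_left)
  show "r *\<^sub>R s *\<^sub>R a = (r * s) *\<^sub>R a" by transfer simp
  show "1 *\<^sub>R a = a" by transfer simp
  show "dist a b = norm (a - b)" by (rule dist_l1_matrix_def)
  show "sgn a = inverse (norm a) *\<^sub>R a" by (simp add: sgn_l1_matrix_def)
  show "uniformity = (INF e\<in>{0 <..}. principal {(a, b :: 'a l1_matrix). dist a b < e})"
    by (rule uniformity_l1_matrix_def)
  show "open S = (\<forall>x\<in>S. \<forall>\<^sub>F (x', y) in uniformity. x' = x \<longrightarrow> y \<in> S)"
    by (rule open_l1_matrix_def)
  show "(norm a = 0) = (a = 0)"
  proof
    assume "norm a = 0"
    then have "entry a i j = 0" for i j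
      using l1_norm_entry[of "entry a" i j] entry[of a] by (simp add: norm_l1_matrix.rep_eq)
    then show "a = 0" by (auto intro!: l1_matrix_eqI simp: zero_l1_matrix.rep_eq)
  qed (simp add: norm_l1_matrix.rep_eq zero_l1_matrix.rep_eq case_prod_unfold)
  show "norm (a + b) \<le> norm a + norm b" by transfer (rule l1_summable_add)
  show "norm (r *\<^sub>R a) = \<bar>r\<bar> * norm a"
    by transfer (simp add: scaleR_conv_of_real l1_summable_cmult)
  show "z *\<^sub>C (a + b) = z *\<^sub>C a + z *\<^sub>C b" by transfer (simp add: algebra_simps)
  show "(z + w) *\<^sub>C a = z *\<^sub>C a + w *\<^sub>C a" by transfer (simp add: algebra_simps)
  show "z *\<^sub>C w *\<^sub>C a = (z * w) *\<^sub>C a" by transfer (simp add: mult.assoc)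
  show "complex_of_real r *\<^sub>C a = r *\<^sub>R a" by transfer (simp add: scaleR_conv_of_real)
  show "norm (z *\<^sub>C a) = cmod z * norm a" by transfer (rule l1_summable_cmult)
qed

end

instance l1_matrix :: (type) complex_banach
proof
  fix X :: "nat \<Rightarrow> 'a l1_matrix"
  assume X: "Cauchy X"
  have entry_le: "cmod (entry a i j) \<le> norm a" for a :: "'a l1_matrix" and i j
    using l1_norm_entry[of "entry a" i j] entry[of a] by (simp add: norm_l1_matrix.rep_eq)
  have entry_diff: "entry (a - b) i j = entry a i j - entry b i j" for a b :: "'a l1_matrix" and i j
    by (simp add: minus_l1_matrix.rep_eq)
  have Xe: "\<exists>M. \<forall>m\<ge>M. \<forall>n\<ge>M. norm (X m - X n) < e" if "e > 0" for e
    using X that unfolding Cauchy_def dist_norm by blast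
  have "Cauchy (\<lambda>n. entry (X n) i j)" for i j
    unfolding Cauchy_def dist_norm entry_diff[symmetric]
    using Xe entry_le by (meson le_less_trans)
  then have "\<forall>i j. \<exists>l. (\<lambda>n. entry (X n) i j) \<longlonglongrightarrow> l"
    using Cauchy_convergent_iff convergent_def by blast
  then obtain l where l: "\<And>i j. (\<lambda>n. entry (X n) i j) \<longlonglongrightarrow> l i j" by metis
  have fin: "(\<Sum>(i, j)\<in>F. cmod (l i j - entry (X n) i j)) \<le> e"
    if "finite F" and M: "\<forall>m\<ge>M. \<forall>n\<ge>M. norm (X m - X n) < e" "n \<ge> M" for F M n e
  proof (rule LIMSEQ_le_const2)
    show "(\<lambda>m. \<Sum>(i, j)\<in>F. cmod (entry (X m) i j - entry (X n) i j))
        \<longlonglongrightarrow> (\<Sum>(i, j)\<in>F. cmod (l i j - entry (X n) i j))"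
      unfolding case_prod_unfold by (intro tendsto_sum tendsto_norm tendsto_diff l tendsto_const)
    have "(\<Sum>(i, j)\<in>F. cmod (entry (X m) i j - entry (X n) i j)) \<le> e" if "m \<ge> M" for m
    proof -
      have "(\<Sum>(i, j)\<in>F. cmod (entry (X m - X n) i j)) \<le> norm (X m - X n)"
        unfolding norm_l1_matrix.rep_eq
        by (rule finite_sum_le_infsum) (use entry[of "X m - X n"] \<open>finite F\<close> in auto)
      also have "\<dots> \<le> e" using M that by (simp add: less_imp_le)
      finally show ?thesis by (simp add: entry_diff)
    qed
    then show "\<exists>N. \<forall>m\<ge>N. (\<Sum>(i, j)\<in>F. cmod (entry (X m) i j - entry (X n) i j)) \<le> e" by blast
  qed
  have diff: "l1_summable (\<lambda>i j. l i j - entry (X n) i j)"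
    if M: "\<forall>m\<ge>M. \<forall>n\<ge>M. norm (X m - X n) < e" "n \<ge> M" for M n e
  proof (rule nonneg_bdd_above_summable_on)
    show "bdd_above (sum (\<lambda>(i, j). cmod (l i j - entry (X n) i j)) ` {F. F \<subseteq> UNIV \<and> finite F})"
      by (rule bdd_aboveI2[of _ _ e]) (use fin M in auto)
  qed auto
  obtain M1 where M1: "\<forall>m\<ge>M1. \<forall>n\<ge>M1. norm (X m - X n) < 1" using Xe[of 1] by auto
  have "l1_summable (\<lambda>i j. (l i j - entry (X M1) i j) + entry (X M1) i j)"
    using diff[OF M1] entry[of "X M1"] by (intro l1_summable_add) auto
  then have "entry (Abs_l1_matrix l) = l" by (simp add: Abs_l1_matrix_inverse)
  note L = this
  have "X \<longlonglongrightarrow> Abs_l1_matrix l"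
    unfolding LIMSEQ_def
  proof (intro allI impI)
    fix r :: real assume "r > 0"
    then obtain M where M: "\<forall>m\<ge>M. \<forall>n\<ge>M. norm (X m - X n) < r / 2" using Xe[of "r / 2"] by auto
    have "dist (X n) (Abs_l1_matrix l) < r" if "n \<ge> M" for n
    proof -
      have "norm (X n - Abs_l1_matrix l) = l1_norm (\<lambda>i j. l i j - entry (X n) i j)"
        by (simp add: norm_l1_matrix.rep_eq entry_diff L norm_minus_commute)
      also have "\<dots> \<le> r / 2"
        by (rule infsum_le_finite_sums[OF diff[OF M that]]) (use fin[OF _ M that] in auto)
      finally show ?thesis using \<open>r > 0\<close> by (simp add: dist_norm)
    qed
    then show "\<exists>N. \<forall>n\<ge>N. dist (X n) (Abs_l1_matrix l) < r" by blast
  qed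
  then show "convergent X" by (auto simp: convergent_def)
qed

instantiation l1_matrix :: (type) complex_banach_algebra
begin

lift_definition times_l1_matrix :: "'a l1_matrix \<Rightarrow> 'a l1_matrix \<Rightarrow> 'a l1_matrix"
  is "\<lambda>a b i j. \<Sum>\<^sub>\<infinity>k. a i k * b k j" by (rule l1_summable_mult)

instance
proof
  fix a b c :: "'a l1_matrix" and r :: real and z :: complex
  have E: "entry (a * b) i j = (\<Sum>\<^sub>\<infinity>k. entry a i k * entry b k j)"
    "entry (a + b) i j = entry a i j + entry b i j" "entry (r *\<^sub>R a) i j = r *\<^sub>R entry a i j"
    "entry (z *\<^sub>C a) i j = z * entry a i j" for a b :: "'a l1_matrix" and i j r z
    by (simp_all add: times_l1_matrix.rep_eq plus_l1_matrix.rep_eq scaleR_l1_matrix.rep_eq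
        scaleC_l1_matrix.rep_eq)
  have summable: "l1_summable (entry a)" for a :: "'a l1_matrix" using entry[of a] by simp
  have row: "(\<lambda>k. entry a i k * entry b k j) summable_on UNIV" for a b :: "'a l1_matrix" and i j
    by (rule l1_summable_mult_row[OF summable summable])
  have L: "(z *\<^sub>C a) * b = z *\<^sub>C (a * b)" for z
  proof (rule l1_matrix_eqI)
    fix i j
    show "entry ((z *\<^sub>C a) * b) i j = entry (z *\<^sub>C (a * b)) i j"
      unfolding E mult.assoc by (rule infsum_cmult_right')
  qed
  have R: "a * (z *\<^sub>C b) = z *\<^sub>C (a * b)" for z
  proof (rule l1_matrix_eqI)
    fix i j
    show "entry (a * (z *\<^sub>C b)) i j = entry (z *\<^sub>C (a * b)) i j"
      unfolding E mult.left_commute[of _ z] by (rule infsum_cmult_right')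
  qed
  show "z *\<^sub>C a * b = z *\<^sub>C (a * b)" "a * z *\<^sub>C b = z *\<^sub>C (a * b)" by (rule L R)+
  show "r *\<^sub>R a * b = r *\<^sub>R (a * b)" "a * r *\<^sub>R b = r *\<^sub>R (a * b)"
    using L[of "of_real r"] R[of "of_real r"] by (simp_all add: scaleC_of_real)
  show "a * b * c = a * (b * c)"
    by (rule l1_matrix_eqI) (unfold E, rule l1_mult_assoc[OF summable summable summable])
  show "(a + b) * c = a * c + b * c"
    by (rule l1_matrix_eqI) (unfold E distrib_right, rule infsum_add[OF row row])
  show "a * (b + c) = a * b + a * c"
    by (rule l1_matrix_eqI) (unfold E distrib_left, rule infsum_add[OF row row])
  show "norm (a * b) \<le> norm a * norm b"
    unfolding norm_l1_matrix.rep_eq times_l1_matrix.rep_eq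
    by (rule l1_summable_mult(3)[OF summable summable])
qed

end

end

theory Submission
  imports Defs
begin

text \<open>If \<open>\<Lambda>\<close> is finite, the identity matrix is a unit of the algebra, and its image in the bidual,
  as a constant net, is an ultra central approximate identity.

  Conversely, let \<open>m\<close> be an element of the bidual that commutes with the algebra. Evaluating
  \<open>\<epsilon>\<^sub>i\<^sub>j \<cdot> m = m \<cdot> \<epsilon>\<^sub>i\<^sub>j\<close> at the coordinate functional \<open>\<phi>\<^sub>i\<^sub>j\<close> of the matrix unit \<open>\<epsilon>\<^sub>i\<^sub>j\<close> gives
  \<open>m(\<phi>\<^sub>j\<^sub>j) = m(\<phi>\<^sub>i\<^sub>i)\<close>, so \<open>m\<close> has a constant diagonal \<open>c\<close>. Every partial trace
  \<open>\<Sum>\<^bsub>i\<in>F\<^esub> \<phi>\<^sub>i\<^sub>i\<close> has norm at most \<open>1\<close> on matrices with the \<open>\<ell>\<^sup>1\<close>-norm, and \<open>m\<close> sends it to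
  \<open>c\<close> times the cardinality of \<open>F\<close>. Hence the cardinality of \<open>F\<close> times \<open>\<bar>c\<bar>\<close> never exceeds \<open>\<parallel>m\<parallel>\<close>,
  and \<open>c = 0\<close> as soon as \<open>\<Lambda>\<close> is infinite
  (\<open>central_bidual_diagonal_eq_0\<close>). Then \<open>m \<cdot> \<epsilon>\<^sub>i\<^sub>i\<close> and \<open>\<epsilon>\<^sub>i\<^sub>i\<close> take the values \<open>0\<close> and \<open>1\<close> at
  \<open>\<phi>\<^sub>i\<^sub>i\<close>, so no net of such \<open>m\<close> can satisfy \<open>m \<cdot> \<epsilon>\<^sub>i\<^sub>i \<longrightarrow> \<epsilon>\<^sub>i\<^sub>i\<close>, bounded or not.\<close>


lemmas dual_mult_apply =
  banach_bimodule.dual_lact_apply[OF banach_bimodule_mult]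
  banach_bimodule.dual_ract_apply[OF banach_bimodule_mult]

lemmas banach_bimodule_dual_mult =
  banach_bimodule.banach_bimodule_dual[OF banach_bimodule_mult]

lemma bidual_lact_apply:
  "cdual_apply (bidual_lact a m) f = cdual_apply m (dual_ract (*) f a)"
  unfolding bidual_lact_def
  by (rule banach_bimodule.dual_lact_apply[OF banach_bimodule_dual_mult])

lemma bidual_ract_apply:
  "cdual_apply (bidual_ract m a) f = cdual_apply m (dual_lact (*) a f)"
  unfolding bidual_ract_def
  by (rule banach_bimodule.dual_ract_apply[OF banach_bimodule_dual_mult])

lemma bidual_lact_embed: "bidual_lact a (bidual_embed x) = bidual_embed (a * x)"
  by (rule cdual_eqI) (simp add: bidual_lact_apply bidual_embed_apply dual_mult_apply)

lemma bidual_ract_embed: "bidual_ract (bidual_embed x) a = bidual_embed (x * a)"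
  by (rule cdual_eqI) (simp add: bidual_ract_apply bidual_embed_apply dual_mult_apply)

lemma unital_has_ultra_central_approximate_identity:
  fixes u :: "'a::complex_banach_algebra"
  assumes "\<And>a. a * u = a" "\<And>a. u * a = a"
  shows "has_ultra_central_approximate_identity TYPE('a)"
proof (rule has_ultra_central_approximate_identityI)
  show "ultra_central_approximate_identity {()} (\<lambda>_ _. True) (\<lambda>_. bidual_embed u)"
    by (auto simp: ultra_central_approximate_identity_def directed_index_def reflp_on_def
        transp_on_def bidual_lact_embed bidual_ract_embed assms)
qed

lift_definition matrix_unit :: "'l \<Rightarrow> 'l \<Rightarrow> 'l l1_matrix"
  is "\<lambda>k l i j. if i = k \<and> j = l then 1 else 0"
  subgoal for k l
    by (rule summable_on_cong_neutral[where S = "{(k, l)}", THEN iffD1])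
      (auto split: if_splits)
  done

lemma entry_mult_matrix_unit:
  "entry (x * matrix_unit k l) i j = (if j = l then entry x i k else 0)"
proof -
  have "entry (x * matrix_unit k l) i j
      = (\<Sum>\<^sub>\<infinity>n\<in>{k}. entry x i n * (if j = l then 1 else 0))"
    unfolding times_l1_matrix.rep_eq matrix_unit.rep_eq
    by (rule infsum_cong_neutral) auto
  then show ?thesis by simp
qed

lemma entry_matrix_unit_mult:
  "entry (matrix_unit k l * x) i j = (if i = k then entry x l j else 0)"
proof -
  have "entry (matrix_unit k l * x) i j
      = (\<Sum>\<^sub>\<infinity>n\<in>{l}. (if i = k then 1 else 0) * entry x n j)"
    unfolding times_l1_matrix.rep_eq matrix_unit.rep_eq
    by (rule infsum_cong_neutral) auto
  then show ?thesis by simp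
qed

lemma finite_l1_matrix_unital:
  assumes "finite (UNIV :: 'l set)"
  obtains u :: "'l l1_matrix" where "\<And>a. a * u = a" "\<And>a. u * a = a"
proof -
  have "l1_summable (\<lambda>i j :: 'l. if i = j then 1 else 0)"
    using assms by (intro summable_on_finite) (simp add: finite_Prod_UNIV)
  then have u: "entry (Abs_l1_matrix (\<lambda>i j :: 'l. if i = j then 1 else 0))
      = (\<lambda>i j. if i = j then 1 else 0)"
    by (intro Abs_l1_matrix_inverse) simp
  show thesis
    by (rule that[of "Abs_l1_matrix (\<lambda>i j. if i = j then 1 else 0)"]; rule l1_matrix_eqI)
      (simp_all add: times_l1_matrix.rep_eq u infsum_finite assms sum.delta
        if_distrib[of "\<lambda>z. _ * z"] if_distrib[of "\<lambda>z. z * _"] cong: if_cong)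
qed

lemma sum_diagonal_le_norm:
  assumes "finite F"
  shows "(\<Sum>i\<in>F. cmod (entry x i i)) \<le> norm x"
proof -
  have "(\<Sum>i\<in>F. cmod (entry x i i)) = (\<Sum>(i, j)\<in>(\<lambda>i. (i, i)) ` F. cmod (entry x i j))"
    by (subst sum.reindex) (auto simp: inj_on_def)
  also have "\<dots> \<le> norm x"
    unfolding norm_l1_matrix.rep_eq
    by (rule finite_sum_le_infsum) (use assms entry[of x] in auto)
  finally show ?thesis .
qed

definition coordinate :: "'l \<Rightarrow> 'l \<Rightarrow> 'l l1_matrix cdual"
  where "coordinate i j = Cdual (\<lambda>x. entry x i j)"

lemma cdual_apply_coordinate: "cdual_apply (coordinate i j) x = entry x i j"
  unfolding coordinate_def
proof (rule cdual_apply_Cdual)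
  show "bounded_linear (\<lambda>x. entry x i j)"
  proof (rule bounded_linear_intro[of _ 1])
    show "cmod (entry x i j) \<le> norm x * 1" for x :: "'a l1_matrix"
      using l1_norm_entry[of "entry x" i j] entry[of x] by (simp add: norm_l1_matrix.rep_eq)
  qed (simp_all add: plus_l1_matrix.rep_eq scaleR_l1_matrix.rep_eq)
qed (simp add: scaleC_l1_matrix.rep_eq)

lemma cdual_apply_sum_left:
  "cdual_apply (\<Sum>i\<in>F. f i) x = (\<Sum>i\<in>F. cdual_apply (f i) x)"
  by (induction F rule: infinite_finite_induct) auto

lemma norm_partial_trace:
  assumes "finite F"
  shows "norm (\<Sum>i\<in>F. coordinate i i) \<le> 1"
proof (rule norm_cdual_bound)
  fix x :: "'a l1_matrix"
  have "cmod (\<Sum>i\<in>F. entry x i i) \<le> (\<Sum>i\<in>F. cmod (entry x i i))"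
    by (rule norm_sum)
  also have "\<dots> \<le> norm x" by (rule sum_diagonal_le_norm[OF assms])
  finally show "cmod (cdual_apply (\<Sum>i\<in>F. coordinate i i) x) \<le> 1 * norm x"
    by (simp add: cdual_apply_sum_left cdual_apply_coordinate)
qed simp

lemma matrix_unit_act_coordinate:
  "dual_lact (*) (matrix_unit k j) (coordinate i j) = coordinate i k"
  "dual_ract (*) (coordinate i j) (matrix_unit i l) = coordinate l j"
  by (rule cdual_eqI, simp add: dual_mult_apply cdual_apply_coordinate entry_mult_matrix_unit
      entry_matrix_unit_mult)+

lemma central_bidual_diagonal_constant:
  fixes m :: "'l l1_matrix bidual"
  assumes "\<And>a. bidual_lact a m = bidual_ract m a"
  shows "cdual_apply m (coordinate i i) = cdual_apply m (coordinate j j)"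
  using arg_cong[OF assms[of "matrix_unit i j"], of "\<lambda>g. cdual_apply g (coordinate i j)"]
  by (simp add: bidual_lact_apply bidual_ract_apply matrix_unit_act_coordinate)

text \<open>The partial traces over finite sets of growing cardinality stay in the unit ball of the dual,
  whereas their values under a functional with constant diagonal grow linearly.\<close>

lemma central_bidual_diagonal_eq_0:
  fixes m :: "'l l1_matrix bidual"
  assumes inf: "infinite (UNIV :: 'l set)"
    and central: "\<And>a. bidual_lact a m = bidual_ract m a"
  shows "cdual_apply m (coordinate i i) = 0"
proof (rule ccontr)
  let ?c = "cdual_apply m (coordinate i i)"
  assume "?c \<noteq> 0"
  then obtain n where n: "norm m < of_nat n * cmod ?c"
    using reals_Archimedean3[of "cmod ?c"] by auto
  obtain F :: "'l set" where F: "finite F" "card F = n"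
    using infinite_arbitrarily_large[OF inf] by blast
  have "cdual_apply m (\<Sum>j\<in>F. coordinate j j) = (\<Sum>j\<in>F. cdual_apply m (coordinate j j))"
    by (rule linear_sum[OF bounded_linear.linear[OF bounded_linear_cdual_apply]])
  also have "\<dots> = (\<Sum>j\<in>F. ?c)"
    by (intro sum.cong refl central_bidual_diagonal_constant central)
  finally have "of_nat n * cmod ?c = cmod (cdual_apply m (\<Sum>j\<in>F. coordinate j j))"
    by (simp add: norm_mult F)
  also have "\<dots> \<le> norm m * norm (\<Sum>j\<in>F. coordinate j j)" by (rule norm_cdual_apply)
  also have "\<dots> \<le> norm m" using norm_partial_trace[OF F(1)] by (simp add: mult_left_le)
  finally show False using n by simp
qed

lemma infinite_imp_no_ultra_central_approximate_identity:
  fixes e :: "'i \<Rightarrow> 'l l1_matrix bidual"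
  assumes inf: "infinite (UNIV :: 'l set)"
  shows "\<not> ultra_central_approximate_identity I le e"
proof
  assume e: "ultra_central_approximate_identity I le e"
  fix i :: 'l
  let ?u = "matrix_unit i i" and ?f = "coordinate i i"
  have d: "directed_index I le"
    and lim: "((\<lambda>\<alpha>. bidual_ract (e \<alpha>) ?u) \<longlongrightarrow> bidual_embed ?u) (net_filter I le)"
    using e by (auto simp: ultra_central_approximate_identity_def)
  have "eventually (\<lambda>\<alpha>. dist (bidual_ract (e \<alpha>) ?u) (bidual_embed ?u) < 1) (net_filter I le)"
    by (rule tendstoD[OF lim]) simp
  then obtain \<alpha> where \<alpha>: "\<alpha> \<in> I" "norm (bidual_ract (e \<alpha>) ?u - bidual_embed ?u) < 1"
    using d by (auto simp: eventually_net_filter directed_index_def reflp_on_def dist_norm)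
  have "cdual_apply (e \<alpha>) ?f = 0"
    using e \<alpha>(1) by (intro central_bidual_diagonal_eq_0[OF inf])
      (auto simp: ultra_central_approximate_identity_def)
  then have "1 = cmod (cdual_apply (bidual_ract (e \<alpha>) ?u - bidual_embed ?u) ?f)"
    by (simp add: bidual_ract_apply bidual_embed_apply matrix_unit_act_coordinate
        cdual_apply_coordinate matrix_unit.rep_eq)
  also have "\<dots> \<le> norm (bidual_ract (e \<alpha>) ?u - bidual_embed ?u) * norm ?f"
    by (rule norm_cdual_apply)
  also have "\<dots> \<le> norm (bidual_ract (e \<alpha>) ?u - bidual_embed ?u)"
    using norm_partial_trace[of "{i}"] by (simp add: mult_left_le)
  finally show False using \<alpha>(2) by simp
qed

theorem theorem2p1:
  shows "has_ultra_central_approximate_identity TYPE('l l1_matrix) \<longleftrightarrow> finite (UNIV :: 'l set)"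
proof
  assume "has_ultra_central_approximate_identity TYPE('l l1_matrix)"
  then show "finite (UNIV :: 'l set)"
    using infinite_imp_no_ultra_central_approximate_identity
    unfolding has_ultra_central_approximate_identity_def by blast
next
  assume "finite (UNIV :: 'l set)"
  then obtain u :: "'l l1_matrix" where "\<And>a. a * u = a" "\<And>a. u * a = a"
    using finite_l1_matrix_unital by blast
  then show "has_ultra_central_approximate_identity TYPE('l l1_matrix)"
    by (rule unital_has_ultra_central_approximate_identity)
qed

end
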